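(* Let $n\ge 1$, and for $A\in\mathbb{C}^{n\times n}$, $J\subset\{1,\dots,n\}$ and $x\in\mathbb{C}^n$ let $Y_J(x)$ denote the samples $\{(Ax)(j)\}_{j\in J}\cup\{x(j)\}_{j\in\{1,\dots,n\}\setminus J}$. If $A\in\mathcal{W}_n$ and $J\subset\{1,\dots,n\}$, then any $x\in\mathbb{C}^n$ can be recovered from the samples $Y_J(x)$, i.e. the map $x\mapsto Y_J(x)$ is injective. Conversely, if for a given $A\in\mathbb{C}^{n\times n}$ the map $x\mapsto Y_J(x)$ is injective for all $J\subset\{1,\dots,n\}$, then $A\in\mathcal{W}_n$.
   Context: The central sub-matrices of a matrix $A=(a_{i,j})_{i,j=1}^n$ are the matrices $(a_{j,k})_{j,k\in J}$ where $J$ is any nonempty subset of $\{1,\dots,n\}$. $\mathcal{W}_n$ is the set of matrices in $\mathbb{C}^{n\times n}$ all of whose central sub-matrices are invertible. For $y\in\mathbb{C}^n$, $y(j)$ denotes its $j$-th coordinate. The samples $Y_J(x)$ are regarded as a vector in $\mathbb{C}^n$, indexed by $j\in\{1,\dots,n\}$, with $j$-th entry $(Ax)(j)$ if $j\in J$ and $x(j)$ if $j\notin J$. *)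

theory Defs
  imports Complex_Main "Jordan_Normal_Form.DL_Submatrix"
begin

text \<open>
  Coordinates of \<open>\<complex>\<^sup>n\<close> are numbered \<open>0, \<dots>, n - 1\<close>, as for all vectors and matrices here,
  so the index sets \<open>J \<subseteq> {1, \<dots>, n}\<close> become subsets of \<open>{0..<n}\<close>.
\<close>

definition central_submatrix :: "'a mat \<Rightarrow> nat set \<Rightarrow> 'a mat" where
  "central_submatrix A J = submatrix A J J"

definition W :: "nat \<Rightarrow> complex mat set" where
  "W n = {A \<in> carrier_mat n n.
     \<forall>J. J \<subseteq> {0..<n} \<longrightarrow> J \<noteq> {} \<longrightarrow> invertible_mat (central_submatrix A J)}"

definition samples :: "complex mat \<Rightarrow> nat set \<Rightarrow> complex vec \<Rightarrow> complex vec" where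
  "samples A J x = vec (dim_vec x) (\<lambda>j. if j \<in> J then (A *\<^sub>v x) $ j else x $ j)"

end

theory Submission
  imports Defs "Jordan_Normal_Form.Determinant"
begin

text \<open>
  The equivalence already holds for each index set \<open>J\<close> separately: the map \<open>x \<mapsto> Y\<^sub>J(x)\<close> is
  injective if and only if the central sub-matrix of \<open>A\<close> on \<open>J\<close> is invertible
  (\<open>inj_on_samples_iff_invertible\<close>).

  Since the map is linear, injectivity means that its kernel is trivial. A vector \<open>z\<close> lies in the
  kernel exactly when its coordinates vanish outside \<open>J\<close> and those of \<open>A z\<close> vanish on \<open>J\<close>. For
  such a \<open>z\<close> only the columns in \<open>J\<close> contribute to \<open>A z\<close>, so the coordinates of \<open>A z\<close> on \<open>J\<close> are
  those of the central sub-matrix applied to the restriction of \<open>z\<close> to \<open>J\<close>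
  (\<open>central_submatrix_mult_restrict\<close>). Restriction to \<open>J\<close> is a bijection from the vectors
  supported in \<open>J\<close> onto all vectors of length \<open>card J\<close>, so it identifies the kernel of the sampling
  map with the kernel of the central sub-matrix; and a square matrix over a field is invertible if
  and only if its kernel is trivial.

  The empty index set, which the definition of \<open>\<W>\<^sub>n\<close> leaves out, does no harm: there the samples
  are the coordinates of \<open>x\<close> itself.
\<close>

section \<open>Invertibility and kernels\<close>

text \<open>
  Multiplying \<open>M v = 0\<close> by an inverse gives \<open>v = 0\<close>. Conversely, a square matrix with trivial
  kernel has nonzero determinant, which makes it a unit of the ring of square matrices.
\<close>

lemma invertible_mat_iff_trivial_kernel:
  fixes M :: "'a :: field mat"
  assumes M: "M \<in> carrier_mat k k"
  shows "invertible_mat M \<longleftrightarrow> (\<forall>v \<in> carrier_vec k. M *\<^sub>v v = 0\<^sub>v k \<longrightarrow> v = 0\<^sub>v k)"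
proof
  assume "invertible_mat M"
  then obtain B where MB: "M * B = 1\<^sub>m k" and BM: "B * M = 1\<^sub>m (dim_row B)"
    using M by (auto simp: invertible_mat_def inverts_mat_def)
  have B: "B \<in> carrier_mat k k"
    using arg_cong[OF MB, of dim_col] arg_cong[OF BM, of dim_col] M by auto
  show "\<forall>v \<in> carrier_vec k. M *\<^sub>v v = 0\<^sub>v k \<longrightarrow> v = 0\<^sub>v k"
  proof (intro ballI impI)
    fix v :: "'a vec" assume v: "v \<in> carrier_vec k" and Mv: "M *\<^sub>v v = 0\<^sub>v k"
    have "v = (B * M) *\<^sub>v v" using BM B v by simp
    also have "\<dots> = B *\<^sub>v (M *\<^sub>v v)" using B M v by simp
    also have "\<dots> = 0\<^sub>v k" unfolding Mv using B by (auto intro!: eq_vecI)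
    finally show "v = 0\<^sub>v k" .
  qed
next
  assume "\<forall>v \<in> carrier_vec k. M *\<^sub>v v = 0\<^sub>v k \<longrightarrow> v = 0\<^sub>v k"
  then have "det M \<noteq> 0" using det_0_iff_vec_prod_zero_field[OF M] by blast
  from det_non_zero_imp_unit[OF M this, of "()"] M
  show "invertible_mat M"
    by (auto simp: Units_def ring_mat_def invertible_mat_def inverts_mat_def)
qed

section \<open>Restriction to an index set\<close>

lemma bij_betw_pick:
  assumes "finite J"
  shows "bij_betw (pick J) {0..<card J} J"
proof -
  have inj: "inj_on (pick J) {0..<card J}"
    by (rule linorder_inj_onI) (auto dest!: pick_mono_le[of _ J])
  moreover have "pick J ` {0..<card J} \<subseteq> J"
    by (auto intro: pick_in_set_le)
  ultimately have "pick J ` {0..<card J} = J"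
    using assms by (intro card_subset_eq) (auto simp: card_image)
  with inj show ?thesis by (simp add: bij_betw_def)
qed

lemma dims_central_submatrix:
  assumes "A \<in> carrier_mat n n" and "J \<subseteq> {0..<n}"
  shows "central_submatrix A J \<in> carrier_mat (card J) (card J)"
proof -
  have "{i. i < n \<and> i \<in> J} = J" using assms by auto
  then show ?thesis
    using assms by (auto simp: central_submatrix_def dim_submatrix)
qed

text \<open>
  The columns outside \<open>J\<close> are multiplied by zero entries of \<open>z\<close>; what remains of each row sum
  runs over \<open>J\<close>, which \<open>pick J\<close> enumerates.
\<close>

lemma central_submatrix_mult_restrict:
  fixes A :: "'a :: comm_semiring_0 mat"
  assumes A: "A \<in> carrier_mat n n" and J: "J \<subseteq> {0..<n}" and z: "z \<in> carrier_vec n"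
    and supp: "\<And>j. j < n \<Longrightarrow> j \<notin> J \<Longrightarrow> z $ j = 0"
    and i: "i < card J"
  shows "(central_submatrix A J *\<^sub>v vec (card J) (\<lambda>k. z $ pick J k)) $ i = (A *\<^sub>v z) $ pick J i"
proof -
  have fin: "finite J" using J finite_subset by blast
  have rows: "{i. i < n \<and> i \<in> J} = J" using J by auto
  have pick_less: "pick J i < n" using pick_in_set_le[OF i] J by auto
  have entry: "central_submatrix A J $$ (i, k) = A $$ (pick J i, pick J k)" if "k < card J" for k
    using that i A by (simp add: central_submatrix_def submatrix_index rows)
  have "(central_submatrix A J *\<^sub>v vec (card J) (\<lambda>k. z $ pick J k)) $ i
      = (\<Sum>k = 0..<card J. A $$ (pick J i, pick J k) * z $ pick J k)"
    using dims_central_submatrix[OF A J] i by (simp add: scalar_prod_def entry)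
  also have "\<dots> = (\<Sum>j\<in>J. A $$ (pick J i, j) * z $ j)"
    by (rule sum.reindex_bij_betw[OF bij_betw_pick[OF fin]])
  also have "\<dots> = (\<Sum>j = 0..<n. A $$ (pick J i, j) * z $ j)"
    using J supp by (intro sum.mono_neutral_left) auto
  also have "\<dots> = (A *\<^sub>v z) $ pick J i"
    using A z pick_less by (simp add: scalar_prod_def)
  finally show ?thesis .
qed

section \<open>The kernel of the sampling map\<close>

lemma samples_minus:
  assumes "A \<in> carrier_mat n n" and "x \<in> carrier_vec n" and "y \<in> carrier_vec n"
  shows "samples A J (x - y) = samples A J x - samples A J y"
  using assms by (intro eq_vecI) (auto simp: samples_def mult_minus_distrib_mat_vec)

lemma samples_eq_0_iff:
  assumes "z \<in> carrier_vec n"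
  shows "samples A J z = 0\<^sub>v n \<longleftrightarrow>
    (\<forall>j < n. j \<notin> J \<longrightarrow> z $ j = 0) \<and> (\<forall>j < n. j \<in> J \<longrightarrow> (A *\<^sub>v z) $ j = 0)"
  using assms by (auto simp: samples_def vec_eq_iff)

lemma inj_on_samples_iff_trivial_kernel:
  assumes A: "A \<in> carrier_mat n n"
  shows "inj_on (samples A J) (carrier_vec n) \<longleftrightarrow>
    (\<forall>z \<in> carrier_vec n. samples A J z = 0\<^sub>v n \<longrightarrow> z = 0\<^sub>v n)"
proof
  assume inj: "inj_on (samples A J) (carrier_vec n)"
  have "samples A J (0\<^sub>v n) = 0\<^sub>v n"
    using A by (auto simp: samples_eq_0_iff)
  then show "\<forall>z \<in> carrier_vec n. samples A J z = 0\<^sub>v n \<longrightarrow> z = 0\<^sub>v n"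
    using inj by (metis inj_onD zero_carrier_vec)
next
  assume ker: "\<forall>z \<in> carrier_vec n. samples A J z = 0\<^sub>v n \<longrightarrow> z = 0\<^sub>v n"
  show "inj_on (samples A J) (carrier_vec n)"
  proof (rule inj_onI)
    fix x y assume x: "x \<in> carrier_vec n" and y: "y \<in> carrier_vec n"
      and eq: "samples A J x = samples A J y"
    have "samples A J y \<in> carrier_vec n" using y by (simp add: samples_def)
    then have "samples A J (x - y) = 0\<^sub>v n"
      using samples_minus[OF A x y] eq by simp
    then have "x - y = 0\<^sub>v n" using ker x y by simp
    then show "x = y" using x y by (auto simp: vec_eq_iff)
  qed
qed

text \<open>
  Restricting to \<open>J\<close> carries the kernel of the sampling map into that of the central sub-matrix,
  and extending by zero outside \<open>J\<close> carries the latter back into the former.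
\<close>

theorem inj_on_samples_iff_invertible:
  assumes A: "A \<in> carrier_mat n n" and J: "J \<subseteq> {0..<n}"
  shows "inj_on (samples A J) (carrier_vec n) \<longleftrightarrow> invertible_mat (central_submatrix A J)"
proof -
  let ?M = "central_submatrix A J" and ?restr = "\<lambda>z. vec (card J) (\<lambda>k. z $ pick J k)"
  have M: "?M \<in> carrier_mat (card J) (card J)" by (rule dims_central_submatrix[OF A J])
  have fin: "finite J" using J finite_subset by blast
  note bij = bij_betw_pick[OF fin]
  have all_J: "(\<forall>j \<in> J. P j) \<longleftrightarrow> (\<forall>i < card J. P (pick J i))" for P
    by (auto simp: bij_betw_ball[OF bij])
  have pick_less: "pick J i < n" if "i < card J" for i
    using pick_in_set_le[OF that] J by auto
  have kernel: "samples A J z = 0\<^sub>v n \<longleftrightarrow> ?M *\<^sub>v ?restr z = 0\<^sub>v (card J)"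
    if z: "z \<in> carrier_vec n" and supp: "\<And>j. j < n \<Longrightarrow> j \<notin> J \<Longrightarrow> z $ j = 0" for z
  proof -
    have "samples A J z = 0\<^sub>v n \<longleftrightarrow> (\<forall>j \<in> J. (A *\<^sub>v z) $ j = 0)"
      using samples_eq_0_iff[OF z] supp J by auto
    also have "\<dots> \<longleftrightarrow> (\<forall>i < card J. (?M *\<^sub>v ?restr z) $ i = 0)"
      using central_submatrix_mult_restrict[OF A J z supp] by (simp add: all_J)
    also have "\<dots> \<longleftrightarrow> ?M *\<^sub>v ?restr z = 0\<^sub>v (card J)"
      using M by (auto simp: vec_eq_iff)
    finally show ?thesis .
  qed
  have "(\<forall>z \<in> carrier_vec n. samples A J z = 0\<^sub>v n \<longrightarrow> z = 0\<^sub>v n) \<longleftrightarrow>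
      (\<forall>v \<in> carrier_vec (card J). ?M *\<^sub>v v = 0\<^sub>v (card J) \<longrightarrow> v = 0\<^sub>v (card J))"
  proof (intro iffI ballI impI)
    fix v assume ker: "\<forall>z \<in> carrier_vec n. samples A J z = 0\<^sub>v n \<longrightarrow> z = 0\<^sub>v n"
      and v: "v \<in> carrier_vec (card J)" and Mv: "?M *\<^sub>v v = 0\<^sub>v (card J)"
    define z where
      "z = vec n (\<lambda>j. if j \<in> J then v $ the_inv_into {0..<card J} (pick J) j else 0)"
    have z: "z \<in> carrier_vec n" by (simp add: z_def)
    have z_pick: "z $ pick J k = v $ k" if "k < card J" for k
      using that pick_less pick_in_set_le the_inv_into_f_f[OF bij_betw_imp_inj_on[OF bij], of k]
      by (simp add: z_def)
    have restr: "?restr z = v" using v by (auto simp: z_pick)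
    have "samples A J z = 0\<^sub>v n"
      using kernel[OF z] Mv restr by (simp add: z_def)
    then have "z = 0\<^sub>v n" using ker z by blast
    then show "v = 0\<^sub>v (card J)" using v z_pick pick_less by (auto simp: vec_eq_iff)
  next
    fix z assume ker: "\<forall>v \<in> carrier_vec (card J). ?M *\<^sub>v v = 0\<^sub>v (card J) \<longrightarrow> v = 0\<^sub>v (card J)"
      and z: "z \<in> carrier_vec n" and samples: "samples A J z = 0\<^sub>v n"
    have supp: "z $ j = 0" if "j < n" "j \<notin> J" for j
      using that samples samples_eq_0_iff[OF z] by blast
    have "?restr z = 0\<^sub>v (card J)"
      using ker kernel[OF z supp] samples by simp
    then have "\<forall>i < card J. z $ pick J i = 0" by (auto simp: vec_eq_iff)
    then have "\<forall>j \<in> J. z $ j = 0" by (simp add: all_J)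
    then show "z = 0\<^sub>v n" using z supp by (auto simp: vec_eq_iff)
  qed
  then show ?thesis
    by (simp only: inj_on_samples_iff_trivial_kernel[OF A] invertible_mat_iff_trivial_kernel[OF M])
qed

theorem corollary2p8:
  fixes n :: nat
  assumes "n \<ge> 1"
  shows "(\<forall>A \<in> W n. \<forall>J. J \<subseteq> {0..<n} \<longrightarrow> inj_on (samples A J) (carrier_vec n)) \<and>
    (\<forall>A \<in> carrier_mat n n.
       (\<forall>J. J \<subseteq> {0..<n} \<longrightarrow> inj_on (samples A J) (carrier_vec n)) \<longrightarrow> A \<in> W n)"
proof (intro conjI ballI allI impI)
  fix A J assume A: "A \<in> W n" and J: "J \<subseteq> {0..<n}"
  show "inj_on (samples A J) (carrier_vec n)"
  proof (cases "J = {}")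
    case True
    then have "samples A J x = x" for x by (auto simp: samples_def)
    then show ?thesis by (auto intro: inj_onI)
  next
    case False
    then show ?thesis
      using A J inj_on_samples_iff_invertible by (auto simp: W_def)
  qed
next
  fix A :: "complex mat"
  assume "A \<in> carrier_mat n n"
    and "\<forall>J. J \<subseteq> {0..<n} \<longrightarrow> inj_on (samples A J) (carrier_vec n)"
  then show "A \<in> W n"
    using inj_on_samples_iff_invertible by (auto simp: W_def)
qed

end
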